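(* Let $\gamma_1>0$, $\gamma_2>0$, $\bm{\Sigma}_0\in\mathbb{S}^p_{++}$, $\bm{\mu}_0,\bar{\bm{\mu}}\in\mathbb{R}^p$, $0<\bar\gamma_1<\bar\gamma_2$, $\theta\ge 0$, let $X\subseteq\mathbb{R}^n$ be a closed convex set, and let $$h(\bm{x},\bm{\xi})=\max_{k\in\{1,\dots,K\}}\{\bm{a}_k(\bm{x})^T\bm{\xi}+b_k(\bm{x})\},$$ where $\bm{a}_k:\mathbb{R}^n\to\mathbb{R}^p$ and $b_k:\mathbb{R}^n\to\mathbb{R}$ are linear for all $k$. Let $\phi(\bm{\xi},\bm{\xi}')=\theta\|\bm{\xi}-\bm{\xi}'\|_2$, and let $$Y=\{\bm{\xi}\in\mathbb{R}^p : (\bm{\xi}-\bar{\bm{\mu}})^T\bm{\Sigma}_0^{-1}(\bm{\xi}-\bar{\bm{\mu}})\le\bar\gamma_1\},\qquad \Xi=\{\bm{\xi}\in\mathbb{R}^p : (\bm{\xi}-\bar{\bm{\mu}})^T\bm{\Sigma}_0^{-1}(\bm{\xi}-\bar{\bm{\mu}})\le\bar\gamma_2\}.$$ Then the semi-infinite problem $$\begin{aligned} \min_{\bm{x},\bm{\Lambda},\bm{q},t}\quad & t+\bm{\Lambda}\cdot(\gamma_2\bm{\Sigma}_0+\bm{\mu}_0\bm{\mu}_0^T)+\sqrt{\gamma_1}\,\|\bm{\Sigma}_0^{1/2}(\bm{q}+2\bm{\Lambda}\bm{\mu}_0)\|_2+\bm{q}^T\bm{\mu}_0\\ \text{s.t.}\quad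 & h(\bm{x},\bm{\xi})-\bm{\xi}^T\bm{\Lambda}\bm{\xi}-\bm{q}^T\bm{\xi}-t\le\min_{\bm{\xi}'\in Y}\phi(\bm{\xi},\bm{\xi}')\qquad\forall\,\bm{\xi}\in\Xi,\\ & \bm{\Lambda}\in\mathbb{S}^p_+,\ \bm{q}\in\mathbb{R}^p,\ t\in\mathbb{R},\ \bm{x}\in X \end{aligned}$$ is equivalent to the semidefinite problem $$\begin{aligned} \min_{\bm{x},\bm{\Lambda},\bm{q},t,\bm{v}_k,\bm{w}_k,z_{1k},z_{2k}}\quad & t+\bm{\Lambda}\cdot(\gamma_2\bm{\Sigma}_0+\bm{\mu}_0\bm{\mu}_0^T)+\sqrt{\gamma_1}\,\|\bm{\Sigma}_0^{1/2}(\bm{q}+2\bm{\Lambda}\bm{\mu}_0)\|_2+\bm{q}^T\bm{\mu}_0\\ \text{s.t.}\quad & \begin{bmatrix}\bm{\Lambda} & \frac12(\bm{v}_k+\bm{w}_k+\bm{q}-\bm{a}_k(\bm{x}))\\ \frac12(\bm{v}_k+\bm{w}_k+\bm{q}-\bm{a}_k(\bm{x}))^T & t-b_k(\bm{x})-\bar{\bm{\mu}}^T(\bm{v}_k+\bm{w}_k)-z_{1k}-z_{2k}\end{bmatrix}\in\mathbb{S}^{p+1}_+,\\ & \sqrt{\bar\gamma_1}\,\|\bm{\Sigma}_0^{1/2}\bm{v}_k\|_2\le z_{1k},\qquad \sqrt{\bar\gamma_2}\,\|\bm{\Sigma}_0^{1/2}\bm{w}_k\|_2\le z_{2k},\qquad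 \|\bm{v}_k\|_2\le\theta,\\ & \bm{v}_k,\bm{w}_k\in\mathbb{R}^p,\ z_{1k},z_{2k}\in\mathbb{R},\quad 1\le k\le K,\\ & \bm{\Lambda}\in\mathbb{S}^p_+,\ \bm{q}\in\mathbb{R}^p,\ t\in\mathbb{R},\ \bm{x}\in X, \end{aligned}$$ in the sense that $(\bm{x},\bm{\Lambda},\bm{q},t)$ is feasible for the first problem if and only if there exist $\bm{v}_k,\bm{w}_k,z_{1k},z_{2k}$ ($1\le k\le K$) such that $(\bm{x},\bm{\Lambda},\bm{q},t,(\bm{v}_k,\bm{w}_k,z_{1k},z_{2k})_{k=1}^K)$ is feasible for the second; the objective functions coincide, so the two problems have the same optimal value and the same optimal $(\bm{x},\bm{\Lambda},\bm{q},t)$.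
   Context: $\mathbb{S}^p$ is the set of real symmetric $p\times p$ matrices; $\mathbb{S}^p_+$ and $\mathbb{S}^p_{++}$ are its subsets of positive semidefinite and positive definite matrices. $\bm{A}\cdot\bm{B}=\mathrm{tr}(\bm{A}^T\bm{B})$ is the trace inner product. $\bm{\Sigma}_0^{1/2}$ is a fixed $p\times p$ matrix with $\bm{\Sigma}_0=(\bm{\Sigma}_0^{1/2})^T\bm{\Sigma}_0^{1/2}$. $n,p,K$ are positive integers. *)

theory Defs
  imports "HOL-Analysis.Analysis"
begin

definition sym_matrices :: "(real^'p^'p) set" where
  "sym_matrices = {A. transpose A = A}"

definition psd_matrices :: "(real^'p^'p) set" where
  "psd_matrices = {A \<in> sym_matrices. \<forall>x. 0 \<le> x \<bullet> (A *v x)}"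

definition pd_matrices :: "(real^'p^'p) set" where
  "pd_matrices = {A \<in> sym_matrices. \<forall>x. x \<noteq> 0 \<longrightarrow> 0 < x \<bullet> (A *v x)}"

definition trace_inner :: "real^'p^'p \<Rightarrow> real^'p^'p \<Rightarrow> real" where
  "trace_inner A B = trace (transpose A ** B)"

definition outer_product :: "real^'p \<Rightarrow> real^'p \<Rightarrow> real^'p^'p" where
  "outer_product u v = (\<chi> i j. u $ i * v $ j)"

text \<open>The block matrix with rows \<open>(A, c)\<close> and \<open>(c\<^sup>T, d)\<close>. Its index type \<open>'p option\<close> has
  \<open>CARD('p) + 1\<close> elements; \<open>None\<close> is the index of the last row and column.\<close>

definition bordered_matrix :: "real^'p^'p \<Rightarrow> real^'p \<Rightarrow> real \<Rightarrow> real^('p option)^('p option)" where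
  "bordered_matrix A c d = (\<chi> i j.
     case (i, j) of
       (Some r, Some s) \<Rightarrow> A $ r $ s
     | (Some r, None) \<Rightarrow> c $ r
     | (None, Some s) \<Rightarrow> c $ s
     | (None, None) \<Rightarrow> d)"

definition ellipsoid :: "real^'p \<Rightarrow> real^'p^'p \<Rightarrow> real \<Rightarrow> (real^'p) set" where
  "ellipsoid c S r = {\<xi>. (\<xi> - c) \<bullet> (matrix_inv S *v (\<xi> - c)) \<le> r}"

text \<open>Minimization of \<open>f\<close> over a feasible set \<open>F\<close>. The value is extended real: it is \<open>\<infinity>\<close> for an
  empty feasible set and \<open>-\<infinity>\<close> for an unbounded problem.\<close>

definition optimal_value :: "('a \<Rightarrow> real) \<Rightarrow> 'a set \<Rightarrow> ereal" where
  "optimal_value f F = (INF u\<in>F. ereal (f u))"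

definition optimal_solutions :: "('a \<Rightarrow> real) \<Rightarrow> 'a set \<Rightarrow> 'a set" where
  "optimal_solutions f F = {u. is_arg_min f (\<lambda>u. u \<in> F) u}"

text \<open>The parameter \<open>R\<close> below plays the role of \<open>\<Sigma>\<^sub>0\<^sup>1\<^sup>/\<^sup>2\<close>: a matrix with \<open>\<Sigma>\<^sub>0 = R\<^sup>T R\<close>, not
  necessarily symmetric.\<close>

type_synonym ('n, 'p) sip_point =
  "(real^'n) \<times> (real^'p^'p) \<times> (real^'p) \<times> real"

definition sip_objective ::
  "real \<Rightarrow> real \<Rightarrow> real^'p^'p \<Rightarrow> real^'p^'p \<Rightarrow> real^'p \<Rightarrow> ('n, 'p) sip_point \<Rightarrow> real" where
  "sip_objective \<gamma>\<^sub>1 \<gamma>\<^sub>2 \<Sigma>\<^sub>0 R \<mu>\<^sub>0 = (\<lambda>(x, \<Lambda>, q, t).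
     t + trace_inner \<Lambda> (\<gamma>\<^sub>2 *\<^sub>R \<Sigma>\<^sub>0 + outer_product \<mu>\<^sub>0 \<mu>\<^sub>0)
       + sqrt \<gamma>\<^sub>1 * norm (R *v (q + 2 *\<^sub>R (\<Lambda> *v \<mu>\<^sub>0))) + q \<bullet> \<mu>\<^sub>0)"

text \<open>The minimum of \<open>\<phi> \<xi>\<close> over \<open>Y\<close> is written as an infimum; the two agree whenever the minimum
  is attained, in particular for \<open>\<phi> \<xi>\<close> continuous and \<open>Y\<close> compact and nonempty.\<close>

definition sip_feasible ::
  "(real^'n) set \<Rightarrow> (real^'n \<Rightarrow> real^'p \<Rightarrow> real) \<Rightarrow> (real^'p \<Rightarrow> real^'p \<Rightarrow> real)
    \<Rightarrow> (real^'p) set \<Rightarrow> (real^'p) set \<Rightarrow> ('n, 'p) sip_point set" where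
  "sip_feasible X h \<phi> Y \<Xi> = {(x, \<Lambda>, q, t).
     (\<forall>\<xi>\<in>\<Xi>. h x \<xi> - \<xi> \<bullet> (\<Lambda> *v \<xi>) - q \<bullet> \<xi> - t \<le> (INF \<xi>'\<in>Y. \<phi> \<xi> \<xi>')) \<and>
     \<Lambda> \<in> psd_matrices \<and> x \<in> X}"

text \<open>The families \<open>v, w, z\<^sub>1, z\<^sub>2\<close> are functions of the index; only their values on \<open>{1..K}\<close>
  are constrained, and the objective does not depend on them.\<close>

type_synonym ('n, 'p) sdp_point =
  "(real^'n) \<times> (real^'p^'p) \<times> (real^'p) \<times> real \<times>
    (nat \<Rightarrow> real^'p) \<times> (nat \<Rightarrow> real^'p) \<times> (nat \<Rightarrow> real) \<times> (nat \<Rightarrow> real)"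

definition sdp_objective ::
  "real \<Rightarrow> real \<Rightarrow> real^'p^'p \<Rightarrow> real^'p^'p \<Rightarrow> real^'p \<Rightarrow> ('n, 'p) sdp_point \<Rightarrow> real" where
  "sdp_objective \<gamma>\<^sub>1 \<gamma>\<^sub>2 \<Sigma>\<^sub>0 R \<mu>\<^sub>0 = (\<lambda>(x, \<Lambda>, q, t, v, w, z\<^sub>1, z\<^sub>2).
     t + trace_inner \<Lambda> (\<gamma>\<^sub>2 *\<^sub>R \<Sigma>\<^sub>0 + outer_product \<mu>\<^sub>0 \<mu>\<^sub>0)
       + sqrt \<gamma>\<^sub>1 * norm (R *v (q + 2 *\<^sub>R (\<Lambda> *v \<mu>\<^sub>0))) + q \<bullet> \<mu>\<^sub>0)"

definition sdp_feasible ::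
  "(real^'n) set \<Rightarrow> nat \<Rightarrow> (nat \<Rightarrow> real^'n \<Rightarrow> real^'p) \<Rightarrow> (nat \<Rightarrow> real^'n \<Rightarrow> real)
    \<Rightarrow> real^'p^'p \<Rightarrow> real^'p \<Rightarrow> real \<Rightarrow> real \<Rightarrow> real \<Rightarrow> ('n, 'p) sdp_point set" where
  "sdp_feasible X K a b R \<mu> g\<^sub>1 g\<^sub>2 \<theta> = {(x, \<Lambda>, q, t, v, w, z\<^sub>1, z\<^sub>2).
     (\<forall>k\<in>{1..K}.
        bordered_matrix \<Lambda> ((1 / 2) *\<^sub>R (v k + w k + q - a k x))
          (t - b k x - \<mu> \<bullet> (v k + w k) - z\<^sub>1 k - z\<^sub>2 k) \<in> psd_matrices \<and>
        sqrt g\<^sub>1 * norm (R *v v k) \<le> z\<^sub>1 k \<and>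
        sqrt g\<^sub>2 * norm (R *v w k) \<le> z\<^sub>2 k \<and>
        norm (v k) \<le> \<theta>) \<and>
     \<Lambda> \<in> psd_matrices \<and> x \<in> X}"

end

theory Submission
  imports Defs
begin

text \<open>The epigraph constraint for the index \<open>k\<close> says that \<open>Q + \<theta> dist(-, Y)\<close> is nonnegative on \<open>\<Xi>\<close>,
  where \<open>Q\<close> is a convex quadratic function. Since this sum is convex and finite everywhere, an
  affine function fits between it and the constant zero on \<open>\<Xi>\<close>; its slope is \<open>-w\<close>. What is left is
  a convex quadratic function dominating the concave function \<open>-\<theta> dist(-, Y)\<close>, and a second
  affine function fits between these two; its slope is \<open>-v\<close>. The constant terms are then controlled
  by the support functions of \<open>\<Xi>\<close> and \<open>Y\<close>, and nonnegativity of the remaining quadratic function on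
  the whole space is the semidefiniteness of the bordered matrix.\<close>

section \<open>Separation of a convex function from a concave one\<close>

lemma affine_sandwich:
  fixes f g :: "'a::euclidean_space \<Rightarrow> real"
  assumes f: "convex_on UNIV f" and g: "concave_on S g" and "S \<noteq> {}"
    and le: "\<And>x. x \<in> S \<Longrightarrow> g x \<le> f x"
  obtains u c where "\<And>x. u \<bullet> x + c \<le> f x" and "\<And>x. x \<in> S \<Longrightarrow> g x \<le> u \<bullet> x + c"
proof -
  \<comment> \<open>The sets to separate are the epigraph of \<open>f\<close> and the hypograph of
    \<open>g\<close> over \<open>S\<close>. The hypograph is strict so that the two stay disjoint
    where \<open>f\<close> and \<open>g\<close> touch.\<close>
  define A where "A = epigraph UNIV f"
  define B where "B = {p. fst p \<in> S \<and> snd p < g (fst p)}"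
  have "convex A"
    unfolding A_def using f by (rule convex_epigraphI)
  moreover have "convex B"
  proof (rule convexI)
    fix p q :: "'a \<times> real" and s t :: real
    assume p: "p \<in> B" and q: "q \<in> B" and st: "0 \<le> s" "0 \<le> t" "s + t = 1"
    have S: "convex S"
      using g by (rule concave_on_imp_convex)
    \<comment> \<open>A weight may vanish, so strictness is taken from a point of positive weight:
      \<open>q\<close> if \<open>s = 0\<close>, otherwise \<open>p\<close>.\<close>
    have "s * snd p + t * snd q < s * g (fst p) + t * g (fst q)"
    proof (cases "s = 0")
      case True
      then show ?thesis
        using q st by (simp add: B_def)
    next
      case False
      then have "s * snd p < s * g (fst p)"
        using p st by (simp add: B_def)
      moreover have "t * snd q \<le> t * g (fst q)"
        using q st by (simp add: B_def mult_left_mono)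
      ultimately show ?thesis
        by linarith
    qed
    also have "\<dots> \<le> g (s *\<^sub>R fst p + t *\<^sub>R fst q)"
      using g p q st unfolding concave_on_iff B_def by auto
    finally show "s *\<^sub>R p + t *\<^sub>R q \<in> B"
      using S p q st by (auto simp: B_def convex_def)
  qed
  moreover have "A \<noteq> {}"
  proof -
    have "(0, f 0) \<in> A" by (simp add: A_def epigraph_def)
    then show ?thesis by blast
  qed
  moreover have "B \<noteq> {}"
  proof -
    obtain x where "x \<in> S" using \<open>S \<noteq> {}\<close> by blast
    then have "(x, g x - 1) \<in> B" by (simp add: B_def)
    then show ?thesis by blast
  qed
  moreover have "A \<inter> B = {}"
    using le by (force simp: A_def B_def epigraph_def)
  ultimately obtain n d where n: "n \<noteq> 0"
    and B: "\<And>p. p \<in> B \<Longrightarrow> n \<bullet> p \<le> d" and A: "\<And>p. p \<in> A \<Longrightarrow> d \<le> n \<bullet> p"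
    using separating_hyperplane_sets[of B A] by blast
  obtain u r where ur: "n = (u, r)" by (cases n)
  have A': "d \<le> u \<bullet> x + r * s" if "f x \<le> s" for x s
    using A[of "(x, s)"] that by (simp add: A_def epigraph_def ur)
  have B': "u \<bullet> x + r * s \<le> d" if "x \<in> S" "s < g x" for x s
    using B[of "(x, s)"] that by (simp add: B_def ur)
  \<comment> \<open>The hyperplane is not vertical. For \<open>r < 0\<close>, going up in the
    epigraph above 0 violates the bound \<open>d\<close>. For \<open>r = 0\<close>, the slope
    \<open>u\<close> is nonzero, and as \<open>f\<close> is finite on the whole space, some multiple
    \<open>x\<close> of \<open>u\<close> violates it.\<close>
  have "r > 0"
  proof (rule ccontr)
    assume "\<not> r > 0"
    consider "r < 0" | "r = 0" using \<open>\<not> r > 0\<close> by linarith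
    then show False
    proof cases
      case 1
      define s where "s = max (f 0) ((d - 1) / r)"
      have "r * s \<le> r * ((d - 1) / r)"
        unfolding s_def using 1 by (intro mult_left_mono_neg) auto
      then show False
        using A'[of 0 s] 1 by (simp add: s_def)
    next
      case 2
      then have "u \<noteq> 0" using n ur by (simp add: zero_prod_def)
      define x where "x = ((d - 1) / (u \<bullet> u)) *\<^sub>R u"
      have "u \<bullet> x = d - 1"
        using \<open>u \<noteq> 0\<close> by (simp add: x_def)
      then show False
        using A'[of x "f x"] 2 by simp
    qed
  qed
  show thesis
  proof (rule that[of "- (u /\<^sub>R r)" "d / r"])
    show "- (u /\<^sub>R r) \<bullet> x + d / r \<le> f x" for x
      using A'[of x "f x"] \<open>r > 0\<close> by (simp add: field_simps)
    show "g x \<le> - (u /\<^sub>R r) \<bullet> x + d / r" if "x \<in> S" for x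
    \<comment> \<open>The strict hypograph bounds only the values below \<open>g x\<close>; density
      carries the bound to \<open>g x\<close> itself.\<close>
    proof (rule dense_le)
      fix s assume "s < g x"
      then show "s \<le> - (u /\<^sub>R r) \<bullet> x + d / r"
        using B'[OF that \<open>s < g x\<close>] \<open>r > 0\<close> by (simp add: field_simps)
    qed
  qed
qed

section \<open>Distance to a convex set\<close>

text \<open>Points \<open>a\<close>, \<open>b\<close> of \<open>S\<close> near \<open>x\<close> and
  \<open>y\<close> combine to a point of \<open>S\<close>, whose distance from the combination of
  \<open>x\<close> and \<open>y\<close> is at most the combination of the distances. The infimum is
  then taken over \<open>a\<close> and afterwards over \<open>b\<close>.\<close>

lemma convex_on_infdist:
  fixes S :: "'a::real_normed_vector set"
  assumes "convex S"
  shows "convex_on UNIV (\<lambda>x. infdist x S)"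
proof (cases "S = {}")
  \<comment> \<open>By convention \<open>infdist\<close> to the empty set is 0.\<close>
  case True
  then show ?thesis by (simp add: infdist_def convex_on_const)
next
  case False
  show ?thesis
  proof (rule convex_onI)
    fix t :: real and x y :: 'a
    assume t: "0 < t" "t < 1"
    define z where "z = (1 - t) *\<^sub>R x + t *\<^sub>R y"
    have ab: "infdist z S \<le> (1 - t) * dist x a + t * dist y b" if "a \<in> S" "b \<in> S" for a b
    proof -
      have "(1 - t) *\<^sub>R a + t *\<^sub>R b \<in> S"
        using assms that t by (simp add: convexD)
      then have "infdist z S \<le> dist z ((1 - t) *\<^sub>R a + t *\<^sub>R b)"
        by (rule infdist_le)
      also have "\<dots> = norm ((1 - t) *\<^sub>R (x - a) + t *\<^sub>R (y - b))"
        by (simp add: dist_norm z_def algebra_simps)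
      also have "\<dots> \<le> (1 - t) * dist x a + t * dist y b"
        using t by (simp add: dist_norm norm_triangle_le)
      finally show ?thesis .
    qed
    have b: "infdist z S \<le> (1 - t) * infdist x S + t * dist y b" if "b \<in> S" for b
    proof -
      \<comment> \<open>Solving for \<open>dist x a\<close> gives a lower bound independent of
        \<open>a\<close>, which passes to the infimum.\<close>
      have "(infdist z S - t * dist y b) / (1 - t) \<le> infdist x S"
        unfolding infdist_notempty[OF False]
        using ab[OF _ that] t False
        by (intro cINF_greatest) (auto simp: divide_le_eq infdist_notempty algebra_simps)
      then show ?thesis using t by (simp add: field_simps)
    qed
    have "(infdist z S - (1 - t) * infdist x S) / t \<le> infdist y S"
      unfolding infdist_notempty[OF False, of y]
    proof (rule cINF_greatest[OF False])
      fix b assume "b \<in> S"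
      then show "(infdist z S - (1 - t) * infdist x S) / t \<le> dist y b"
        using b[of b] t by (simp add: divide_le_eq algebra_simps)
    qed
    then show "infdist ((1 - t) *\<^sub>R x + t *\<^sub>R y) S \<le> (1 - t) * infdist x S + t * infdist y S"
      using t by (simp add: z_def field_simps)
  qed simp
qed

text \<open>A nearest point of the closed set attains the distance, and it stays a minimizer after
  scaling by \<theta> \<ge> 0.\<close>

lemma INF_mult_norm_eq_infdist:
  fixes S :: "'a::euclidean_space set"
  assumes "closed S" and "S \<noteq> {}" and "\<theta> \<ge> 0"
  shows "(INF y\<in>S. \<theta> * norm (x - y)) = \<theta> * infdist x S"
proof -
  obtain y where "y \<in> S" "infdist x S = dist x y"
    using infdist_attains_inf[OF assms(1,2)] by metis
  then show ?thesis
    using assms(3) infdist_le[of _ S x]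
    by (intro cInf_eq_minimum) (auto simp: dist_norm[symmetric] mult_left_mono)
qed

section \<open>Convex quadratic functions and bordered matrices\<close>

text \<open>The gap in the convexity inequality equals \<open>t * (1 - t)\<close> times the
  quadratic form at \<open>x - y\<close>; the affine part cancels.\<close>

lemma convex_on_psd_quadratic:
  fixes A :: "real^'p^'p"
  assumes "A \<in> psd_matrices"
  shows "convex_on UNIV (\<lambda>x. x \<bullet> (A *v x) + c \<bullet> x + d)"
proof (rule convex_onI)
  fix t :: real and x y :: "real^'p"
  assume t: "0 < t" "t < 1"
  define z where "z = (1 - t) *\<^sub>R x + t *\<^sub>R y"
  have "0 \<le> t * (1 - t) * ((x - y) \<bullet> (A *v (x - y)))"
    using assms t by (simp add: psd_matrices_def)
  also have "\<dots> = (1 - t) * (x \<bullet> (A *v x) + c \<bullet> x + d) + t * (y \<bullet> (A *v y) + c \<bullet> y + d)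
      - (z \<bullet> (A *v z) + c \<bullet> z + d)"
    by (simp add: z_def matrix_vector_right_distrib matrix_vector_mult_diff_distrib
        matrix_scaleR_vector_ac scaleR_matrix_vector_assoc[symmetric] inner_simps algebra_simps)
  finally show "z \<bullet> (A *v z) + c \<bullet> z + d
      \<le> (1 - t) * (x \<bullet> (A *v x) + c \<bullet> x + d) + t * (y \<bullet> (A *v y) + c \<bullet> y + d)"
    by simp
qed simp

lemma bordered_matrix_quadratic_form:
  fixes A :: "real^'p^'p"
  shows "z \<bullet> (bordered_matrix A c d *v z) =
    (\<chi> i. z $ Some i) \<bullet> (A *v (\<chi> i. z $ Some i))
      + 2 * (z $ None) * (c \<bullet> (\<chi> i. z $ Some i)) + d * (z $ None)\<^sup>2"
proof -
  have sum_option: "sum f UNIV = f None + (\<Sum>i\<in>UNIV. f (Some i))" for f :: "'p option \<Rightarrow> real"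
    by (simp add: UNIV_option_conv sum.reindex)
  show ?thesis
    by (simp add: inner_vec_def matrix_vector_mult_def bordered_matrix_def sum_option
        sum.distrib sum_distrib_left algebra_simps power2_eq_square)
qed

text \<open>Homogenization: the form of the bordered matrix at \<open>(y, s)\<close> is the
  quadratic polynomial itself for \<open>s = 1\<close>, and \<open>s\<^sup>2\<close> times its value
  at \<open>y /\<^sub>R s\<close> for any \<open>s \<noteq> 0\<close>. For \<open>s = 0\<close> only
  the form of \<open>A\<close> is left.\<close>

lemma bordered_matrix_psd_iff:
  fixes A :: "real^'p^'p"
  assumes A: "A \<in> psd_matrices"
  shows "bordered_matrix A c d \<in> psd_matrices \<longleftrightarrow> (\<forall>x. 0 \<le> x \<bullet> (A *v x) + 2 * (c \<bullet> x) + d)"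
proof
  assume psd: "bordered_matrix A c d \<in> psd_matrices"
  show "\<forall>x. 0 \<le> x \<bullet> (A *v x) + 2 * (c \<bullet> x) + d"
  proof
    fix x :: "real^'p"
    define z :: "real^'p option" where "z = (\<chi> i. case i of None \<Rightarrow> 1 | Some j \<Rightarrow> x $ j)"
    have "(\<chi> i. z $ Some i) = x" "z $ None = 1"
      by (simp_all add: z_def)
    then have "z \<bullet> (bordered_matrix A c d *v z) = x \<bullet> (A *v x) + 2 * (c \<bullet> x) + d"
      by (simp add: bordered_matrix_quadratic_form)
    then show "0 \<le> x \<bullet> (A *v x) + 2 * (c \<bullet> x) + d"
      using psd by (metis (no_types, lifting) psd_matrices_def mem_Collect_eq)
  qed
next
  assume nn: "\<forall>x. 0 \<le> x \<bullet> (A *v x) + 2 * (c \<bullet> x) + d"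
  have "A $ j $ i = A $ i $ j" for i j
    using A by (simp add: psd_matrices_def sym_matrices_def transpose_def vec_eq_iff)
  then have "bordered_matrix A c d \<in> sym_matrices"
    by (auto simp: sym_matrices_def transpose_def vec_eq_iff bordered_matrix_def
        split: option.splits)
  moreover have "0 \<le> z \<bullet> (bordered_matrix A c d *v z)" for z
  proof -
    define y where "y = (\<chi> i. z $ Some i)"
    define s where "s = z $ None"
    have "0 \<le> y \<bullet> (A *v y) + 2 * s * (c \<bullet> y) + d * s\<^sup>2"
    proof (cases "s = 0")
      case True
      then show ?thesis using A by (simp add: psd_matrices_def)
    next
      case False
      have "0 \<le> s\<^sup>2 * ((y /\<^sub>R s) \<bullet> (A *v (y /\<^sub>R s)) + 2 * (c \<bullet> (y /\<^sub>R s)) + d)"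
        using nn by (intro mult_nonneg_nonneg) (blast intro: zero_le_power2)+
      also have "\<dots> = y \<bullet> (A *v y) + 2 * s * (c \<bullet> y) + d * s\<^sup>2"
        using False
        by (simp add: matrix_scaleR_vector_ac scaleR_matrix_vector_assoc[symmetric] field_simps power2_eq_square)
      finally show ?thesis .
    qed
    then show ?thesis
      by (simp add: bordered_matrix_quadratic_form y_def s_def)
  qed
  ultimately show "bordered_matrix A c d \<in> psd_matrices"
    by (simp add: psd_matrices_def)
qed

section \<open>Ellipsoids and their support functions\<close>

lemma matrix_inv_right_inverse:
  assumes "invertible A"
  shows "A ** matrix_inv A = mat 1"
  using assms unfolding invertible_def matrix_inv_def by (rule someI2_ex) blast

text \<open>The substitution \<open>x - c = u v* R\<close>, that is, the transpose of
  \<open>R\<close> applied to \<open>u\<close>, turns the form of the inverse of \<open>S\<close>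
  into \<open>u \<bullet> u\<close>.\<close>

lemma ellipsoid_eq_image:
  fixes R S :: "real^'p^'p"
  assumes pd: "S \<in> pd_matrices" and S: "S = transpose R ** R" and "r \<ge> 0"
  shows "ellipsoid c S r = (\<lambda>u. c + u v* R) ` cball 0 (sqrt r)"
proof -
  \<comment> \<open>Positive definiteness gives \<open>S\<close> a trivial kernel, and a left
    inverse of the product \<open>S\<close> yields one of its factor \<open>R\<close>.\<close>
  have "x = 0" if "S *v x = 0" for x
  proof (rule ccontr)
    assume "x \<noteq> 0"
    then have "0 < x \<bullet> (S *v x)" using pd by (simp add: pd_matrices_def)
    then show False using that by simp
  qed
  then have invS: "invertible S"
    by (simp add: invertible_left_inverse matrix_left_invertible_ker)
  then obtain T where "T ** S = mat 1"
    by (auto simp: invertible_left_inverse)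
  then have "(T ** transpose R) ** R = mat 1"
    by (simp add: S matrix_mul_assoc)
  then have invR: "invertible R"
    by (auto simp: invertible_left_inverse)
  then have invRt: "invertible (transpose R)"
    by (rule transpose_invertible)
  \<comment> \<open>For the vector \<open>y\<close> below, \<open>S *v y\<close> and the
    factorization of \<open>S\<close> give \<open>R *v y = u\<close> once the transpose of
    \<open>R\<close> is cancelled; the form is then \<open>u \<bullet> (R *v y)\<close>.\<close>
  have form: "(u v* R) \<bullet> (matrix_inv S *v (u v* R)) = u \<bullet> u" for u
  proof -
    define y where "y = matrix_inv S *v (u v* R)"
    have "transpose R *v (R *v y) = S *v y"
      by (simp only: S matrix_vector_mul_assoc)
    also have "\<dots> = u v* R"
      using invS by (simp add: y_def matrix_vector_mul_assoc matrix_inv_right_inverse)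
    finally have "transpose R *v (R *v y) = transpose R *v u"
      by simp
    then have "R *v y = u"
      using invRt by (metis inj_matrix_vector_mult injD)
    then show ?thesis
      by (simp add: y_def[symmetric] dot_lmul_matrix)
  qed
  have "x \<in> (\<lambda>u. c + u v* R) ` cball 0 (sqrt r)" if x: "x \<in> ellipsoid c S r" for x
  proof -
    obtain B where "transpose R ** B = mat 1"
      using invRt by (auto simp: invertible_right_inverse)
    then have "transpose R *v (B *v (x - c)) = x - c"
      by (simp only: matrix_vector_mul_assoc matrix_vector_mul_lid)
    then obtain u where u: "x - c = u v* R"
      by (metis transpose_matrix_vector)
    then have "u \<bullet> u \<le> r"
      using x form[of u] by (simp add: ellipsoid_def)
    then have "norm u \<le> sqrt r"
      by (simp add: norm_eq_sqrt_inner)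
    with u show ?thesis
      by (auto simp: image_iff intro!: bexI[of _ u]) (metis add.commute diff_add_cancel)
  qed
  moreover have "c + u v* R \<in> ellipsoid c S r" if "norm u \<le> sqrt r" for u
  proof -
    have "u \<bullet> u \<le> r"
      using that by (simp add: norm_eq_sqrt_inner)
    then show ?thesis
      by (simp add: ellipsoid_def form)
  qed
  ultimately show ?thesis by auto
qed

lemma
  fixes R S :: "real^'p^'p"
  assumes "S \<in> pd_matrices" and "S = transpose R ** R" and "r \<ge> 0"
  shows convex_ellipsoid: "convex (ellipsoid c S r)"
    and compact_ellipsoid: "compact (ellipsoid c S r)"
proof -
  have lin: "linear (\<lambda>u. u v* R)"
    using matrix_vector_mul_linear[of "transpose R"] by simp
  have eq: "ellipsoid c S r = (+) c ` (\<lambda>u. u v* R) ` cball 0 (sqrt r)"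
    using ellipsoid_eq_image[OF assms] by (simp add: image_image)
  show "convex (ellipsoid c S r)"
    unfolding eq by (intro convex_translation convex_linear_image lin convex_cball)
  show "compact (ellipsoid c S r)"
    unfolding eq
    by (intro compact_translation compact_continuous_image compact_cball linear_continuous_on)
      (simp add: lin linear_linear)
qed

lemma center_in_ellipsoid: "r \<ge> 0 \<Longrightarrow> c \<in> ellipsoid c S r"
  by (simp add: ellipsoid_def)

lemma inner_sgn_self: "v \<bullet> sgn v = norm v"
  by (cases "v = 0") (simp_all add: sgn_div_norm dot_square_norm power2_eq_square)

text \<open>On the ball parametrization, \<open>w \<bullet> x\<close> becomes
  \<open>w \<bullet> c + u \<bullet> (R *v w)\<close>, whose maximum over the ball is given by
  Cauchy-Schwarz.\<close>

lemma ellipsoid_support_le_iff: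
  fixes R S :: "real^'p^'p"
  assumes "S \<in> pd_matrices" and "S = transpose R ** R" and r: "r \<ge> 0"
  shows "(\<forall>x\<in>ellipsoid c S r. w \<bullet> x \<le> d) \<longleftrightarrow> w \<bullet> c + sqrt r * norm (R *v w) \<le> d"
proof -
  have eq: "w \<bullet> (c + u v* R) = w \<bullet> c + u \<bullet> (R *v w)" for u
    by (simp add: inner_add_right dot_lmul_matrix[symmetric] inner_commute)
  have "(\<forall>u. norm u \<le> sqrt r \<longrightarrow> w \<bullet> c + u \<bullet> (R *v w) \<le> d)
      \<longleftrightarrow> w \<bullet> c + sqrt r * norm (R *v w) \<le> d" (is "?L \<longleftrightarrow> ?R")
  proof
    assume ?L
    \<comment> \<open>The maximizer is the vector of length \<open>sqrt r\<close> along
      \<open>R *v w\<close>; as \<open>sgn 0 = 0\<close>, it also serves when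
      \<open>R *v w = 0\<close>.\<close>
    define u where "u = sqrt r *\<^sub>R sgn (R *v w)"
    have "norm u \<le> sqrt r"
      using r by (simp add: u_def norm_sgn)
    moreover have "u \<bullet> (R *v w) = sqrt r * norm (R *v w)"
      by (simp add: u_def inner_commute[of "sgn _"] inner_sgn_self)
    ultimately show ?R
      using \<open>?L\<close> by metis
  next
    assume ?R
    have "u \<bullet> (R *v w) \<le> sqrt r * norm (R *v w)" if "norm u \<le> sqrt r" for u
      using norm_cauchy_schwarz[of u "R *v w"] mult_right_mono[OF that, of "norm (R *v w)"]
      by simp
    with \<open>?R\<close> show ?L by fastforce
  qed
  then show ?thesis
    by (simp add: ellipsoid_eq_image[OF assms] eq) (simp add: Ball_def)
qed

text \<open>Along the ray from \<open>c\<close> in direction \<open>v\<close> the left side grows at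
  rate \<open>norm v\<close> and the right side at rate \<theta>.\<close>

lemma norm_le_of_linear_growth:
  fixes v :: "'a::real_inner"
  assumes "\<And>x. v \<bullet> x \<le> \<theta> * norm (x - c) + d" and "\<theta> \<ge> 0"
  shows "norm v \<le> \<theta>"
proof (rule ccontr)
  assume "\<not> norm v \<le> \<theta>"
  then have pos: "norm v - \<theta> > 0" and "v \<noteq> 0"
    using assms(2) by auto
  define e where "e = d - v \<bullet> c"
  \<comment> \<open>Chosen so that \<open>s * (norm v - \<theta>)\<close> is
    \<open>\<bar>e\<bar> + 1\<close>, which exceeds the bound \<open>e\<close>.\<close>
  define s where "s = (\<bar>e\<bar> + 1) / (norm v - \<theta>)"
  have "s \<ge> 0"
    using pos by (simp add: s_def)
  have "s * (norm v - \<theta>) \<le> e"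
    using assms(1)[of "c + s *\<^sub>R sgn v"] \<open>s \<ge> 0\<close> \<open>v \<noteq> 0\<close>
    by (simp add: e_def inner_add_right inner_sgn_self norm_sgn algebra_simps)
  then show False
    using pos by (simp add: s_def)
qed

section \<open>Multipliers for a single constraint\<close>

text \<open>For the index \<open>k\<close>, the parameters \<open>A\<close>, \<open>c\<close> and
  \<open>s\<close> become \<Lambda>, \<open>q - a k x\<close> and \<open>t - b k x\<close>.\<close>

lemma quadratic_plus_infdist_nonneg_iff:
  fixes A R S :: "real^'p^'p"
  assumes A: "A \<in> psd_matrices" and S: "S \<in> pd_matrices" "S = transpose R ** R"
    and g: "g\<^sub>1 \<ge> 0" "g\<^sub>2 \<ge> 0" and \<theta>: "\<theta> \<ge> 0"
  shows "(\<forall>x\<in>ellipsoid \<mu> S g\<^sub>2. 0 \<le> x \<bullet> (A *v x) + c \<bullet> x + s + \<theta> * infdist x (ellipsoid \<mu> S g\<^sub>1)) \<longleftrightarrow>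
    (\<exists>v w z\<^sub>1 z\<^sub>2.
       bordered_matrix A ((1 / 2) *\<^sub>R (v + w + c)) (s - \<mu> \<bullet> (v + w) - z\<^sub>1 - z\<^sub>2) \<in> psd_matrices \<and>
       sqrt g\<^sub>1 * norm (R *v v) \<le> z\<^sub>1 \<and> sqrt g\<^sub>2 * norm (R *v w) \<le> z\<^sub>2 \<and> norm v \<le> \<theta>)"
    (is "?nonneg \<longleftrightarrow> ?multipliers")
proof -
  define Y where "Y = ellipsoid \<mu> S g\<^sub>1"
  have Y: "convex Y" "closed Y" "\<mu> \<in> Y"
    using convex_ellipsoid[OF S g(1)] compact_ellipsoid[OF S g(1)] center_in_ellipsoid[OF g(1)]
    by (auto simp: Y_def compact_imp_closed)
  show ?thesis
  proof
    assume ?nonneg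
    have d: "convex_on UNIV (\<lambda>x. \<theta> * infdist x Y)"
      using convex_on_infdist[OF Y(1)] \<theta> by (rule convex_on_cmul[rotated])
    have "convex_on UNIV (\<lambda>x. x \<bullet> (A *v x) + c \<bullet> x + s + \<theta> * infdist x Y)"
      by (intro convex_on_add convex_on_psd_quadratic A d)
    moreover have "concave_on (ellipsoid \<mu> S g\<^sub>2) (\<lambda>x. 0)"
      using convex_ellipsoid[OF S g(2)] by (simp add: concave_on_def convex_on_const)
    \<comment> \<open>The upper bound \<open>w\<close> on the affine function holds everywhere, the
      lower bound \<open>e\<close> on the larger ellipsoid.\<close>
    ultimately obtain w e
      where w: "\<And>x. w \<bullet> x + e \<le> x \<bullet> (A *v x) + c \<bullet> x + s + \<theta> * infdist x Y"
        and e: "\<And>x. x \<in> ellipsoid \<mu> S g\<^sub>2 \<Longrightarrow> 0 \<le> w \<bullet> x + e"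
    proof (rule affine_sandwich)
      show "ellipsoid \<mu> S g\<^sub>2 \<noteq> {}"
        using center_in_ellipsoid[OF g(2)] by blast
      show "0 \<le> x \<bullet> (A *v x) + c \<bullet> x + s + \<theta> * infdist x Y" if "x \<in> ellipsoid \<mu> S g\<^sub>2" for x
        using \<open>?nonneg\<close> that by (simp add: Y_def)
    qed auto
    have "concave_on UNIV (\<lambda>x. - (\<theta> * infdist x Y))"
      using d by (simp add: concave_on_def)
    with convex_on_psd_quadratic[OF A, of "c - w" "s - e"]
    obtain v f
      where vQ: "\<And>x. v \<bullet> x + f \<le> x \<bullet> (A *v x) + (c - w) \<bullet> x + (s - e)"
        and vd: "\<And>x. - (\<theta> * infdist x Y) \<le> v \<bullet> x + f"
    proof (rule affine_sandwich)
      show "- (\<theta> * infdist x Y) \<le> x \<bullet> (A *v x) + (c - w) \<bullet> x + (s - e)" for x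
        using w[of x] by (simp add: inner_diff_left)
    qed auto
    \<comment> \<open>\<open>e\<close> bounds the support function of the larger ellipsoid at
      \<open>- w\<close>. Likewise \<open>f\<close> bounds that of \<open>Y\<close> at
      \<open>- v\<close> in \<open>z1\<close>, because the distance term vanishes on
      \<open>Y\<close>.\<close>
    have z2: "- w \<bullet> \<mu> + sqrt g\<^sub>2 * norm (R *v (- w)) \<le> e"
      unfolding ellipsoid_support_le_iff[OF S g(2), symmetric]
      using e by (fastforce simp: inner_minus_left)
    have z1: "- v \<bullet> \<mu> + sqrt g\<^sub>1 * norm (R *v (- v)) \<le> f"
      unfolding ellipsoid_support_le_iff[OF S g(1), symmetric] Y_def[symmetric]
    proof
      fix x assume "x \<in> Y"
      then show "- v \<bullet> x \<le> f"
        using vd[of x] by (simp add: inner_minus_left)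
    qed
    \<comment> \<open>As \<mu> lies in \<open>Y\<close>, the distance to \<open>Y\<close> is at most
      \<open>norm (x - \<mu>)\<close>.\<close>
    have "- v \<bullet> x \<le> \<theta> * norm (x - \<mu>) + f" for x
      using vd[of x] mult_left_mono[OF infdist_le[OF Y(3), of x] \<theta>]
      by (simp add: inner_minus_left dist_norm)
    then have "norm (- v) \<le> \<theta>"
      using \<theta> by (rule norm_le_of_linear_growth)
    \<comment> \<open>The multipliers are the negated slopes, with both \<open>z\<close> values at
      their least admissible size; \<open>z1\<close> and \<open>z2\<close> show that the resulting
      constant is at least \<open>s - e - f\<close>.\<close>
    moreover have "bordered_matrix A ((1 / 2) *\<^sub>R (- v + - w + c))
        (s - \<mu> \<bullet> (- v + - w) - sqrt g\<^sub>1 * norm (R *v (- v)) - sqrt g\<^sub>2 * norm (R *v (- w)))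
        \<in> psd_matrices"
      unfolding bordered_matrix_psd_iff[OF A]
    proof
      fix x
      show "0 \<le> x \<bullet> (A *v x) + 2 * ((1 / 2) *\<^sub>R (- v + - w + c) \<bullet> x)
        + (s - \<mu> \<bullet> (- v + - w) - sqrt g\<^sub>1 * norm (R *v (- v)) - sqrt g\<^sub>2 * norm (R *v (- w)))"
        using vQ[of x] z1 z2 by (simp add: inner_simps inner_commute[of \<mu>] field_simps)
    qed
    ultimately show ?multipliers
      by blast
  next
    assume ?multipliers
    then obtain v w z\<^sub>1 z\<^sub>2 where
      Q: "\<And>x. 0 \<le> x \<bullet> (A *v x) + 2 * ((1 / 2) *\<^sub>R (v + w + c) \<bullet> x) + (s - \<mu> \<bullet> (v + w) - z\<^sub>1 - z\<^sub>2)"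
      and z: "sqrt g\<^sub>1 * norm (R *v v) \<le> z\<^sub>1" "sqrt g\<^sub>2 * norm (R *v w) \<le> z\<^sub>2" and v: "norm v \<le> \<theta>"
      by (auto simp: bordered_matrix_psd_iff[OF A])
    show ?nonneg
    proof
      fix x assume x: "x \<in> ellipsoid \<mu> S g\<^sub>2"
      \<comment> \<open>With \<open>y\<close> nearest to \<open>x\<close>, split
        \<open>v \<bullet> x\<close> into \<open>v \<bullet> (x - y)\<close>, bounded by \<theta>
        times the distance, and \<open>v \<bullet> y\<close>, bounded by the support function of
        \<open>Y\<close>.\<close>
      obtain y where y: "y \<in> Y" "infdist x Y = dist x y"
        using infdist_attains_inf[of Y x] Y by blast
      have "v \<bullet> (x - y) \<le> norm v * norm (x - y)"
        by (rule norm_cauchy_schwarz)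
      also have "\<dots> \<le> \<theta> * dist x y"
        using v by (simp add: dist_norm mult_right_mono)
      finally have "v \<bullet> x - v \<bullet> y \<le> \<theta> * dist x y"
        by (simp add: inner_diff_right)
      moreover have "v \<bullet> y \<le> v \<bullet> \<mu> + z\<^sub>1"
      proof -
        have "v \<bullet> \<mu> + sqrt g\<^sub>1 * norm (R *v v) \<le> v \<bullet> \<mu> + z\<^sub>1" using z by simp
        then show ?thesis
          using ellipsoid_support_le_iff[OF S g(1)] y(1) unfolding Y_def by blast
      qed
      moreover have "w \<bullet> x \<le> w \<bullet> \<mu> + z\<^sub>2"
      proof -
        have "w \<bullet> \<mu> + sqrt g\<^sub>2 * norm (R *v w) \<le> w \<bullet> \<mu> + z\<^sub>2" using z by simp
        then show ?thesis
          using ellipsoid_support_le_iff[OF S g(2)] x by blast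
      qed
      ultimately show "0 \<le> x \<bullet> (A *v x) + c \<bullet> x + s + \<theta> * infdist x (ellipsoid \<mu> S g\<^sub>1)"
        using Q[of x] y(2) by (simp add: Y_def inner_simps inner_commute[of \<mu>] field_simps)
    qed
  qed
qed

section \<open>Elimination of the multipliers from the optimization problem\<close>

lemma optimal_value_image:
  assumes "F = f ` G" and "\<And>u. u \<in> G \<Longrightarrow> obj' u = obj (f u)"
  shows "optimal_value obj F = optimal_value obj' G"
  using assms by (simp add: optimal_value_def image_image cong: image_cong)

text \<open>Objective values agree along \<open>f\<close>, so \<open>u\<close> is minimal in
  \<open>G\<close> exactly when \<open>f u\<close> is minimal in \<open>F\<close>.\<close>

lemma optimal_solutions_image:
  assumes "F = f ` G" and "\<And>u. u \<in> G \<Longrightarrow> obj' u = obj (f u)"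
  shows "optimal_solutions obj F = f ` optimal_solutions obj' G"
  using assms by (auto simp: optimal_solutions_def is_arg_min_def)

lemma sip_feasible_iff_sdp_feasible:
  fixes \<Sigma>\<^sub>0 R \<Lambda> :: "real^'p^'p" and X :: "(real^'n) set"
  assumes S: "\<Sigma>\<^sub>0 \<in> pd_matrices" "\<Sigma>\<^sub>0 = transpose R ** R"
    and g: "g\<^sub>1 \<ge> 0" "g\<^sub>2 \<ge> 0" and \<theta>: "\<theta> \<ge> 0" and K: "K \<ge> 1"
  shows "(x, \<Lambda>, q, t) \<in> sip_feasible X (\<lambda>x \<xi>. Max ((\<lambda>k. a k x \<bullet> \<xi> + b k x) ` {1..K}))
      (\<lambda>\<xi> \<xi>'. \<theta> * norm (\<xi> - \<xi>')) (ellipsoid \<mu> \<Sigma>\<^sub>0 g\<^sub>1) (ellipsoid \<mu> \<Sigma>\<^sub>0 g\<^sub>2) \<longleftrightarrow>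
    (\<exists>v w z\<^sub>1 z\<^sub>2. (x, \<Lambda>, q, t, v, w, z\<^sub>1, z\<^sub>2) \<in> sdp_feasible X K a b R \<mu> g\<^sub>1 g\<^sub>2 \<theta>)"
proof (cases "\<Lambda> \<in> psd_matrices \<and> x \<in> X")
  case False
  then show ?thesis
    by (auto simp: sip_feasible_def sdp_feasible_def)
next
  case True
  let ?Y = "ellipsoid \<mu> \<Sigma>\<^sub>0 g\<^sub>1" and ?\<Xi> = "ellipsoid \<mu> \<Sigma>\<^sub>0 g\<^sub>2"
  let ?C = "\<lambda>k v w z\<^sub>1 z\<^sub>2.
    bordered_matrix \<Lambda> ((1 / 2) *\<^sub>R (v + w + q - a k x)) (t - b k x - \<mu> \<bullet> (v + w) - z\<^sub>1 - z\<^sub>2)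
      \<in> psd_matrices \<and>
    sqrt g\<^sub>1 * norm (R *v v) \<le> z\<^sub>1 \<and> sqrt g\<^sub>2 * norm (R *v w) \<le> z\<^sub>2 \<and> norm v \<le> \<theta>"
  have INF: "(INF \<xi>'\<in>?Y. \<theta> * norm (\<xi> - \<xi>')) = \<theta> * infdist \<xi> ?Y" for \<xi>
    using compact_ellipsoid[OF S g(1)] center_in_ellipsoid[OF g(1)] \<theta>
    by (intro INF_mult_norm_eq_infdist) (auto simp: compact_imp_closed)
  have Max: "Max ((\<lambda>k. a k x \<bullet> \<xi> + b k x) ` {1..K}) - \<xi> \<bullet> (\<Lambda> *v \<xi>) - q \<bullet> \<xi> - t \<le> r \<longleftrightarrow>
      (\<forall>k\<in>{1..K}. 0 \<le> \<xi> \<bullet> (\<Lambda> *v \<xi>) + (q - a k x) \<bullet> \<xi> + (t - b k x) + r)" for \<xi> r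
  proof -
    have "Max ((\<lambda>k. a k x \<bullet> \<xi> + b k x) ` {1..K}) - \<xi> \<bullet> (\<Lambda> *v \<xi>) - q \<bullet> \<xi> - t \<le> r \<longleftrightarrow>
        Max ((\<lambda>k. a k x \<bullet> \<xi> + b k x) ` {1..K}) \<le> \<xi> \<bullet> (\<Lambda> *v \<xi>) + q \<bullet> \<xi> + t + r"
      by linarith
    also have "\<dots> \<longleftrightarrow> (\<forall>k\<in>{1..K}. a k x \<bullet> \<xi> + b k x \<le> \<xi> \<bullet> (\<Lambda> *v \<xi>) + q \<bullet> \<xi> + t + r)"
      \<comment> \<open>\<open>K \<ge> 1\<close> makes the index set nonempty, so that
        \<open>Max\<close> is a genuine maximum.\<close>
      using K by simp
    finally show ?thesis
      by (simp add: inner_diff_left algebra_simps)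
  qed
  have "(x, \<Lambda>, q, t) \<in> sip_feasible X (\<lambda>x \<xi>. Max ((\<lambda>k. a k x \<bullet> \<xi> + b k x) ` {1..K}))
      (\<lambda>\<xi> \<xi>'. \<theta> * norm (\<xi> - \<xi>')) ?Y ?\<Xi> \<longleftrightarrow>
    (\<forall>k\<in>{1..K}. \<forall>\<xi>\<in>?\<Xi>. 0 \<le> \<xi> \<bullet> (\<Lambda> *v \<xi>) + (q - a k x) \<bullet> \<xi> + (t - b k x) + \<theta> * infdist \<xi> ?Y)"
    unfolding sip_feasible_def mem_Collect_eq prod.case INF Max using True by blast
  also have "\<dots> \<longleftrightarrow> (\<forall>k\<in>{1..K}. \<exists>v w z\<^sub>1 z\<^sub>2. ?C k v w z\<^sub>1 z\<^sub>2)"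
    using True by (simp only: quadratic_plus_infdist_nonneg_iff[OF _ S g \<theta>] add_diff_eq[of _ q])
  \<comment> \<open>The constraints for different \<open>k\<close> share no multipliers, so these
    can be chosen for each \<open>k\<close> separately and collected into functions of
    \<open>k\<close>.\<close>
  also have "\<dots> \<longleftrightarrow> (\<exists>v w z\<^sub>1 z\<^sub>2. \<forall>k\<in>{1..K}. ?C k (v k) (w k) (z\<^sub>1 k) (z\<^sub>2 k))"
    unfolding bchoice_iff by blast
  also have "\<dots> \<longleftrightarrow> (\<exists>v w z\<^sub>1 z\<^sub>2. (x, \<Lambda>, q, t, v, w, z\<^sub>1, z\<^sub>2) \<in> sdp_feasible X K a b R \<mu> g\<^sub>1 g\<^sub>2 \<theta>)"
    unfolding sdp_feasible_def using True by simp
  finally show ?thesis .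
qed

theorem theorem2p4:
  fixes \<gamma>\<^sub>1 \<gamma>\<^sub>2 g\<^sub>1 g\<^sub>2 \<theta> :: real
    and \<Sigma>\<^sub>0 R :: "real^'p^'p"
    and \<mu>\<^sub>0 \<mu> :: "real^'p"
    and X :: "(real^'n) set"
    and K :: nat
    and a :: "nat \<Rightarrow> real^'n \<Rightarrow> real^'p"
    and b :: "nat \<Rightarrow> real^'n \<Rightarrow> real"
    and h :: "real^'n \<Rightarrow> real^'p \<Rightarrow> real"
    and \<phi> :: "real^'p \<Rightarrow> real^'p \<Rightarrow> real"
    and Y \<Xi> :: "(real^'p) set"
  assumes "\<gamma>\<^sub>1 > 0" and "\<gamma>\<^sub>2 > 0"
    and "\<Sigma>\<^sub>0 \<in> pd_matrices" and "\<Sigma>\<^sub>0 = transpose R ** R"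
    and "0 < g\<^sub>1" and "g\<^sub>1 < g\<^sub>2" and "\<theta> \<ge> 0"
    and "closed X" and "convex X"
    and "K \<ge> 1"
    and "\<And>k. k \<in> {1..K} \<Longrightarrow> linear (a k)"
    and "\<And>k. k \<in> {1..K} \<Longrightarrow> linear (b k)"
    and "h = (\<lambda>x \<xi>. Max ((\<lambda>k. a k x \<bullet> \<xi> + b k x) ` {1..K}))"
    and "\<phi> = (\<lambda>\<xi> \<xi>'. \<theta> * norm (\<xi> - \<xi>'))"
    and "Y = ellipsoid \<mu> \<Sigma>\<^sub>0 g\<^sub>1"
    and "\<Xi> = ellipsoid \<mu> \<Sigma>\<^sub>0 g\<^sub>2"
  shows "(\<forall>x \<Lambda> q t. (x, \<Lambda>, q, t) \<in> sip_feasible X h \<phi> Y \<Xi> \<longleftrightarrow>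
            (\<exists>v w z\<^sub>1 z\<^sub>2. (x, \<Lambda>, q, t, v, w, z\<^sub>1, z\<^sub>2) \<in> sdp_feasible X K a b R \<mu> g\<^sub>1 g\<^sub>2 \<theta>)) \<and>
         (\<forall>(x :: real^'n) \<Lambda> q t v w z\<^sub>1 z\<^sub>2.
            sdp_objective \<gamma>\<^sub>1 \<gamma>\<^sub>2 \<Sigma>\<^sub>0 R \<mu>\<^sub>0 (x, \<Lambda>, q, t, v, w, z\<^sub>1, z\<^sub>2) =
            sip_objective \<gamma>\<^sub>1 \<gamma>\<^sub>2 \<Sigma>\<^sub>0 R \<mu>\<^sub>0 (x, \<Lambda>, q, t)) \<and>
         optimal_value (sip_objective \<gamma>\<^sub>1 \<gamma>\<^sub>2 \<Sigma>\<^sub>0 R \<mu>\<^sub>0) (sip_feasible X h \<phi> Y \<Xi>) =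
         optimal_value (sdp_objective \<gamma>\<^sub>1 \<gamma>\<^sub>2 \<Sigma>\<^sub>0 R \<mu>\<^sub>0) (sdp_feasible X K a b R \<mu> g\<^sub>1 g\<^sub>2 \<theta>) \<and>
         (\<forall>x \<Lambda> q t.
            (x, \<Lambda>, q, t) \<in> optimal_solutions (sip_objective \<gamma>\<^sub>1 \<gamma>\<^sub>2 \<Sigma>\<^sub>0 R \<mu>\<^sub>0) (sip_feasible X h \<phi> Y \<Xi>) \<longleftrightarrow>
            (\<exists>v w z\<^sub>1 z\<^sub>2. (x, \<Lambda>, q, t, v, w, z\<^sub>1, z\<^sub>2) \<in>
               optimal_solutions (sdp_objective \<gamma>\<^sub>1 \<gamma>\<^sub>2 \<Sigma>\<^sub>0 R \<mu>\<^sub>0)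
                 (sdp_feasible X K a b R \<mu> g\<^sub>1 g\<^sub>2 \<theta>)))"
proof -
  let ?F = "sip_feasible X h \<phi> Y \<Xi>" and ?G = "sdp_feasible X K a b R \<mu> g\<^sub>1 g\<^sub>2 \<theta>"
  let ?f = "sip_objective \<gamma>\<^sub>1 \<gamma>\<^sub>2 \<Sigma>\<^sub>0 R \<mu>\<^sub>0 :: ('n, 'p) sip_point \<Rightarrow> real"
  let ?g = "sdp_objective \<gamma>\<^sub>1 \<gamma>\<^sub>2 \<Sigma>\<^sub>0 R \<mu>\<^sub>0 :: ('n, 'p) sdp_point \<Rightarrow> real"
  \<comment> \<open>Under this projection the feasibility equivalence says that one feasible set is
    the image of the other, which carries over both value and solutions.\<close>
  define \<pi> :: "('n, 'p) sdp_point \<Rightarrow> ('n, 'p) sip_point"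
    where "\<pi> = (\<lambda>(x, \<Lambda>, q, t, v, w, z\<^sub>1, z\<^sub>2). (x, \<Lambda>, q, t))"
  have mem_image: "(x, \<Lambda>, q, t) \<in> \<pi> ` G \<longleftrightarrow> (\<exists>v w z\<^sub>1 z\<^sub>2. (x, \<Lambda>, q, t, v, w, z\<^sub>1, z\<^sub>2) \<in> G)"
    for x \<Lambda> q t G
    by (force simp: \<pi>_def image_iff)
  have feasible: "(x, \<Lambda>, q, t) \<in> ?F \<longleftrightarrow> (\<exists>v w z\<^sub>1 z\<^sub>2. (x, \<Lambda>, q, t, v, w, z\<^sub>1, z\<^sub>2) \<in> ?G)" for x \<Lambda> q t
    using assms by (simp only: sip_feasible_iff_sdp_feasible less_imp_le order.strict_trans[of 0 g\<^sub>1 g\<^sub>2])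
  have image: "?F = \<pi> ` ?G"
    unfolding set_eq_iff split_paired_All mem_image feasible by blast
  have obj: "?g u = ?f (\<pi> u)" for u
    by (simp add: sip_objective_def sdp_objective_def \<pi>_def split: prod.split)
  have "optimal_value ?f ?F = optimal_value ?g ?G"
    using image obj by (rule optimal_value_image)
  moreover have "optimal_solutions ?f ?F = \<pi> ` optimal_solutions ?g ?G"
    using image obj by (rule optimal_solutions_image)
  ultimately show ?thesis
    using feasible by (simp add: mem_image) (simp add: sip_objective_def sdp_objective_def)
qed

end
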